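(* Define the mapping $$\varphi:\Sigma^{2}_{\mathbb{R}_{\ge0}}\to\mathbb{R},\qquad \varphi({}^{i}a)=\begin{cases}+a&\text{if } i=1,\\ -a&\text{if } i=2,\\ 0&\text{if } i=0.\end{cases}$$ Then $\varphi$ is a bijection and, for all $x,y\in\Sigma^{2}_{\mathbb{R}_{\ge0}}$, $$\varphi(x\oplus y)=\varphi(x)+\varphi(y),\qquad \varphi(x\otimes y)=\varphi(x)\cdot\varphi(y),\qquad \varphi({}^{1}1)=1,\qquad \varphi({}^{0}0)=0.$$ Hence $\varphi$ is an isomorphism of fields in the classical sense, so $(\Sigma^{2}_{\mathbb{R}_{\ge0}},\oplus,\otimes)$ is (isomorphic to) the field of real numbers.
   Context: **Multisign numbers with two signs.** $\Sigma^{2}_{\mathbb{R}_{\ge0}}$ is the set of formal pairs ${}^{i}a$ with sign $i\in\{0,1,2\}$ and magnitude $a\in\mathbb{R}_{\ge0}$, subject to the conventions that the sign $0$ is reserved for the element ${}^{0}0$, that ${}^{0}0$ is the only element with magnitude $0$, and that for $a>0$ only the signs $1$ and $2$ are permitted. Thus $\Sigma^{2}_{\mathbb{R}_{\ge0}}=\{{}^{0}0\}\cup\{{}^{i}a:i\in\{1,2\},\ a>0\}$. **Operations.** For ${}^{i}a,{}^{j}b\in\Sigma^{2}_{\mathbb{R}_{\ge0}}$, with the usual operations and order on $\mathbb{R}_{\ge0}$ and with $s=2$: $${}^{i}a\oplus{}^{j}b=\begin{cases}{}^{i}(a+b)&\text{if } i=j,\\ {}^{i}(a-b)&\text{if } i\ne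 j,\ a>b,\\ {}^{j}(b-a)&\text{if } i\neq j,\ a<b,\\ {}^{0}0&\text{if } i\ne j,\ a=b,\end{cases}$$ $${}^{i}a\otimes{}^{j}b=\begin{cases}{}^{0}0&\text{if } {}^{i}a={}^{0}0\text{ or }{}^{j}b={}^{0}0,\\ {}^{\,i+j-1-s}(ab)&\text{if both are}\neq{}^{0}0\text{ and } i+j-1>s,\\ {}^{\,i+j-1}(ab)&\text{if both are}\neq{}^{0}0\text{ and } i+j-1\le s.\end{cases}$$ *)

theory Defs
  imports "HOL-Algebra.Algebraic_Closure_Type"
begin

text \<open>The pair \<open>(i, a)\<close> stands for the multisign number with sign \<open>i\<close> and magnitude \<open>a\<close>.\<close>

type_synonym multisign = "nat \<times> real"

definition Sigma2 :: "multisign set" where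
  "Sigma2 = {(0, 0)} \<union> {(i, a). i \<in> {1, 2} \<and> a > 0}"

fun ms_add :: "multisign \<Rightarrow> multisign \<Rightarrow> multisign" where
  "ms_add (i, a) (j, b) =
    (if i = j then (i, a + b)
     else if a > b then (i, a - b)
     else if a < b then (j, b - a)
     else (0, 0))"

text \<open>The number of signs is \<open>s = 2\<close>. In the last two branches both signs are at least 1 on
  \<^const>\<open>Sigma2\<close>, so the subtractions on \<^typ>\<open>nat\<close> do not truncate.\<close>

fun ms_mult :: "multisign \<Rightarrow> multisign \<Rightarrow> multisign" where
  "ms_mult (i, a) (j, b) =
    (if (i, a) = (0, 0) \<or> (j, b) = (0, 0) then (0, 0)
     else if i + j - 1 > 2 then (i + j - 1 - 2, a * b)
     else (i + j - 1, a * b))"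

definition Sigma2_ring :: "multisign ring" where
  "Sigma2_ring = \<lparr>carrier = Sigma2, monoid.mult = ms_mult, one = (1, 1),
                  ring.zero = (0, 0), add = ms_add\<rparr>"

text \<open>Only the values on \<^const>\<open>Sigma2\<close> matter, where the last branch is the case \<open>i = 0\<close>.\<close>

fun phi :: "multisign \<Rightarrow> real" where
  "phi (i, a) = (if i = 1 then a else if i = 2 then - a else 0)"

end

theory Submission
  imports Defs
begin

text \<open>A nonzero real is determined by its sign and its absolute value; sign 1 encodes plus and
  sign 2 encodes minus. \<open>signed_magnitude\<close> is thus a two-sided inverse of
  \<open>phi\<close> between the reals and \<open>Sigma2\<close>. The laws are checked for this
  inverse (\<open>signed_magnitude_add\<close>, \<open>signed_magnitude_mult\<close>), where only
  the signs of two reals have to be distinguished, and then pulled back to \<open>phi\<close>. The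
  field axioms on \<open>Sigma2\<close> are not verified one by one: they are transported from the
  reals along the inverse.\<close>

definition signed_magnitude :: "real \<Rightarrow> multisign" where
  "signed_magnitude x = (if x = 0 then (0, 0) else if x > 0 then (1, x) else (2, - x))"

lemma signed_magnitude_in_Sigma2 [simp]: "signed_magnitude x \<in> Sigma2"
  by (auto simp: signed_magnitude_def Sigma2_def)

lemma phi_signed_magnitude [simp]: "phi (signed_magnitude x) = x"
  by (auto simp: signed_magnitude_def)

lemma signed_magnitude_phi [simp]: "x \<in> Sigma2 \<Longrightarrow> signed_magnitude (phi x) = x"
  by (auto simp: signed_magnitude_def Sigma2_def)

text \<open>For opposite signs, comparing \<open>x + y\<close> with 0 is comparing the two
  magnitudes, which is how \<open>ms_add\<close> branches. A zero summand has magnitude 0 and loses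
  that comparison to any nonzero one.\<close>

lemma signed_magnitude_add:
  "signed_magnitude (x + y) = ms_add (signed_magnitude x) (signed_magnitude y)"
  by (auto simp: signed_magnitude_def)

text \<open>On the signs 1 and 2, \<open>i + j - 1\<close> reduced by 2 when it exceeds 2 is the
  usual rule of signs: 1 is neutral, and two signs 2 give 3, hence 1.\<close>

lemma signed_magnitude_mult:
  "signed_magnitude (x * y) = ms_mult (signed_magnitude x) (signed_magnitude y)"
  by (auto simp: signed_magnitude_def zero_less_mult_iff mult_less_0_iff)

lemma bij_betw_phi: "bij_betw phi Sigma2 UNIV"
  by (rule bij_betwI[where g = signed_magnitude]) auto

lemma bij_betw_signed_magnitude: "bij_betw signed_magnitude UNIV Sigma2"
  by (rule bij_betwI[where g = phi]) auto

text \<open>Both arguments have the form \<open>signed_magnitude (phi _)\<close>, so applying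
  \<open>phi\<close> to the additive law of the inverse gives the claim.\<close>

lemma phi_add:
  assumes "x \<in> Sigma2" "y \<in> Sigma2"
  shows "phi (ms_add x y) = phi x + phi y"
  using signed_magnitude_add[of "phi x" "phi y"] assms
  by (metis phi_signed_magnitude signed_magnitude_phi)

lemma phi_mult:
  assumes "x \<in> Sigma2" "y \<in> Sigma2"
  shows "phi (ms_mult x y) = phi x * phi y"
  using signed_magnitude_mult[of "phi x" "phi y"] assms
  by (metis phi_signed_magnitude signed_magnitude_phi)

text \<open>The isomorphism starts at the reals because the field structure is to be carried from
  its source to its target.\<close>

lemma signed_magnitude_ring_iso:
  "signed_magnitude \<in> ring_iso (ring_of_type_algebra :: real ring) Sigma2_ring"
  by (rule ring_iso_memI)
    (simp_all add: ring_of_type_algebra_def Sigma2_ring_def signed_magnitude_add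
      signed_magnitude_mult bij_betw_signed_magnitude, simp add: signed_magnitude_def)

lemma field_Sigma2_ring: "field Sigma2_ring"
proof -
  \<comment> \<open>The transport theorem yields a field whose zero is replaced by the image of 0;
    here that image is already the zero of \<open>Sigma2_ring\<close>.\<close>
  have "Sigma2_ring \<lparr>zero := signed_magnitude 0\<rparr> = Sigma2_ring"
    by (simp add: Sigma2_ring_def signed_magnitude_def)
  then show ?thesis
    using field.ring_iso_imp_img_field[OF field_from_type_algebra signed_magnitude_ring_iso]
    by (simp add: ring_of_type_algebra_def)
qed

lemma phi_ring_iso: "phi \<in> ring_iso Sigma2_ring (ring_of_type_algebra :: real ring)"
  by (rule ring_iso_memI)
    (simp_all add: ring_of_type_algebra_def Sigma2_ring_def phi_add phi_mult bij_betw_phi)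

theorem theorem4p3:
  shows "bij_betw phi Sigma2 (UNIV :: real set)
    \<and> (\<forall>x\<in>Sigma2. \<forall>y\<in>Sigma2. phi (ms_add x y) = phi x + phi y)
    \<and> (\<forall>x\<in>Sigma2. \<forall>y\<in>Sigma2. phi (ms_mult x y) = phi x * phi y)
    \<and> phi (1, 1) = 1
    \<and> phi (0, 0) = 0
    \<and> field Sigma2_ring
    \<and> field (ring_of_type_algebra :: real ring)
    \<and> phi \<in> ring_iso Sigma2_ring (ring_of_type_algebra :: real ring)
    \<and> Sigma2_ring \<simeq> (ring_of_type_algebra :: real ring)"
  using bij_betw_phi phi_ring_iso field_Sigma2_ring field_from_type_algebra
  by (auto simp: phi_add phi_mult is_ring_iso_def)

end
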